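(* Let $G(F)$ be the group generated by the elementary operations $-,\ r_1,\ r_2,\ *,\ R$ on $PM_{2\times2}(\mathbb Z)$. Then $G(F)$ has the group presentation $$\langle\, x,y,z\mid x^2=y^2=z^2=1,\ xyxy=yxyx,\ xz=zx,\ yz=zy\,\rangle.$$ Furthermore, $G(F)$ is isomorphic to the Coxeter group $C_M$ with Coxeter matrix $M=\begin{pmatrix}1&4&2\\4&1&2\\2&2&1\end{pmatrix}$; that is, $$G(F)=\langle\, x,y,z\mid x^2=y^2=z^2=(xy)^4=(yx)^4=(xz)^2=(zx)^2=(yz)^2=(zy)^2=1\,\rangle.$$
   Context: $PM_{2\times2}(\mathbb Z)$ is the set $M_{2\times2}(\mathbb Z)$ of integer $2\times2$ matrices modulo multiplication by $\pm1$; square brackets denote classes. The elementary operations are the following maps $PM_{2\times2}(\mathbb Z)\to PM_{2\times2}(\mathbb Z)$, written as superscripts: $$\left[\begin{matrix}\alpha&\gamma\\ \beta&\delta\end{matrix}\right]^{*}=\left[\begin{matrix}\alpha&-\gamma\\ -\beta&\delta\end{matrix}\right],\quad \left[\begin{matrix}\alpha&\gamma\\ \beta&\delta\end{matrix}\right]^{-}=\left[\begin{matrix}\delta&\gamma\\ \beta&\alpha\end{matrix}\right],\quad \left[\begin{matrix}\alpha&\gamma\\ \beta&\delta\end{matrix}\right]^{r_1}=\left[\begin{matrix}-\gamma&\alpha\\ -\delta&\beta\end{matrix}\right],$$ $$\left[\begin{matrix}\alpha&\gamma\\ \beta&\delta\end{matrix}\right]^{r_2}=\left[\begin{matrix}-\beta&-\delta\\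 \alpha&\gamma\end{matrix}\right],\quad \left[\begin{matrix}\alpha&\gamma\\ \beta&\delta\end{matrix}\right]^{R}=\left[\begin{matrix}\delta&-\beta\\ -\gamma&\alpha\end{matrix}\right].$$ The group operation in $G(F)$ is the opposite composition of maps (e.g. $-\,r_1$ means first apply $-$, then $r_1$). An $n\times n$ matrix $M$ is a Coxeter matrix if $M_{ii}=1$ and $M_{ij}=M_{ji}>1$ for $i\ne j$; the Coxeter group $C_M$ is the group presented by $\langle x_1,\dots,x_n\mid (x_ix_j)^{M_{ij}}=1\text{ for all }i,j\rangle$. *)

theory Defs
  imports "HOL-Analysis.Analysis" "HOL-Algebra.Algebra"
begin

section \<open>Integer matrices up to sign and the elementary operations\<close>

quotient_type pm_mat = "int^2^2" / "\<lambda>A B. A = B \<or> A = - B"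
  morphisms rep_pm_mat pm_class
  by (rule equivpI) (auto intro!: reflpI sympI transpI)

definition mat22 :: "int \<Rightarrow> int \<Rightarrow> int \<Rightarrow> int \<Rightarrow> int^2^2"
  \<comment> \<open>The entries are listed row by row.\<close>
  where "mat22 a c b d = vector [vector [a, c], vector [b, d]]"

lemma mat22_nth [simp]:
  "mat22 a c b d $ 1 $ 1 = a" "mat22 a c b d $ 1 $ 2 = c"
  "mat22 a c b d $ 2 $ 1 = b" "mat22 a c b d $ 2 $ 2 = d"
  by (simp_all add: mat22_def)

lemma mat22_eq_iff [simp]:
  "mat22 a c b d = mat22 a' c' b' d' \<longleftrightarrow> a = a' \<and> c = c' \<and> b = b' \<and> d = d'"
  by (metis mat22_nth)

lemma uminus_mat22 [simp]: "- mat22 a c b d = mat22 (- a) (- c) (- b) (- d)"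
  by (simp add: vec_eq_iff forall_2)

lemma mat22_entries: "mat22 (A $ 1 $ 1) (A $ 1 $ 2) (A $ 2 $ 1) (A $ 2 $ 2) = A"
  by (simp add: vec_eq_iff forall_2)

text \<open>The formulas for the operations on a bracket \<open>[\<alpha>, \<gamma>; \<beta>, \<delta>]\<close> are collected below in
  \<open>elementary_ops_class\<close>.\<close>

lift_definition op_star :: "pm_mat \<Rightarrow> pm_mat"
  is "\<lambda>A. mat22 (A $ 1 $ 1) (- (A $ 1 $ 2)) (- (A $ 2 $ 1)) (A $ 2 $ 2)"
  by auto

lift_definition op_minus :: "pm_mat \<Rightarrow> pm_mat"
  is "\<lambda>A. mat22 (A $ 2 $ 2) (A $ 1 $ 2) (A $ 2 $ 1) (A $ 1 $ 1)"
  by auto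

lift_definition op_r1 :: "pm_mat \<Rightarrow> pm_mat"
  is "\<lambda>A. mat22 (- (A $ 1 $ 2)) (A $ 1 $ 1) (- (A $ 2 $ 2)) (A $ 2 $ 1)"
  by auto

lift_definition op_r2 :: "pm_mat \<Rightarrow> pm_mat"
  is "\<lambda>A. mat22 (- (A $ 2 $ 1)) (- (A $ 2 $ 2)) (A $ 1 $ 1) (A $ 1 $ 2)"
  by auto

lift_definition op_R :: "pm_mat \<Rightarrow> pm_mat"
  is "\<lambda>A. mat22 (A $ 2 $ 2) (- (A $ 2 $ 1)) (- (A $ 1 $ 2)) (A $ 1 $ 1)"
  by auto

lemma elementary_ops_class:
  "op_star  (pm_class (mat22 \<alpha> \<gamma> \<beta> \<delta>)) = pm_class (mat22 \<alpha> (- \<gamma>) (- \<beta>) \<delta>)"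
  "op_minus (pm_class (mat22 \<alpha> \<gamma> \<beta> \<delta>)) = pm_class (mat22 \<delta> \<gamma> \<beta> \<alpha>)"
  "op_r1    (pm_class (mat22 \<alpha> \<gamma> \<beta> \<delta>)) = pm_class (mat22 (- \<gamma>) \<alpha> (- \<delta>) \<beta>)"
  "op_r2    (pm_class (mat22 \<alpha> \<gamma> \<beta> \<delta>)) = pm_class (mat22 (- \<beta>) (- \<delta>) \<alpha> \<gamma>)"
  "op_R     (pm_class (mat22 \<alpha> \<gamma> \<beta> \<delta>)) = pm_class (mat22 \<delta> (- \<beta>) (- \<gamma>) \<alpha>)"
  by (simp_all add: op_star.abs_eq op_minus.abs_eq op_r1.abs_eq op_r2.abs_eq op_R.abs_eq)

lemma elementary_ops_involutive:
  "op_star (op_star P) = P" "op_minus (op_minus P) = P" "op_r1 (op_r1 P) = P"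
  "op_r2 (op_r2 P) = P" "op_R (op_R P) = P"
  by (transfer; simp add: vec_eq_iff forall_2)+

definition opposite_group :: "('a, 'm) monoid_scheme \<Rightarrow> ('a, 'm) monoid_scheme"
  where "opposite_group G = G\<lparr>mult := \<lambda>a b. b \<otimes>\<^bsub>G\<^esub> a\<rparr>"

definition elementary_ops :: "(pm_mat \<Rightarrow> pm_mat) set"
  where "elementary_ops = {op_minus, op_r1, op_r2, op_star, op_R}"

definition G_F :: "(pm_mat \<Rightarrow> pm_mat) monoid"
  where "G_F = subgroup_generated (opposite_group (BijGroup UNIV)) elementary_ops"

text \<open>\<^const>\<open>subgroup_generated\<close> ignores generators outside the carrier; here there are none.\<close>

lemma elementary_ops_in_carrier: "elementary_ops \<subseteq> carrier (opposite_group (BijGroup UNIV))"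
  by (auto simp: elementary_ops_def opposite_group_def BijGroup_def Bij_def elementary_ops_involutive
      intro: involuntory_imp_bij)

lemma group_opposite_group:
  assumes "group G" shows "group (opposite_group G)"
proof -
  interpret group G by fact
  show ?thesis
    by (rule groupI) (auto simp: opposite_group_def m_assoc intro: r_inv)
qed

lemma group_G_F: "group G_F"
  unfolding G_F_def
  by (intro group.group_subgroup_generated group_opposite_group group_BijGroup)

lemma mult_G_F:
  assumes "f \<in> carrier G_F" "g \<in> carrier G_F"
  shows "f \<otimes>\<^bsub>G_F\<^esub> g = g \<circ> f"
proof -
  have "carrier G_F \<subseteq> carrier (opposite_group (BijGroup UNIV))"
    unfolding G_F_def
    by (intro group.carrier_subgroup_generated_subset group_opposite_group group_BijGroup)
  with assms show ?thesis
    by (auto simp: G_F_def subgroup_generated_def opposite_group_def BijGroup_def compose_def fun_eq_iff)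
qed

section \<open>Group presentations\<close>

text \<open>A word in the generators \<open>'a\<close> and their formal inverses; \<open>(a, True)\<close> is the generator \<open>a\<close> and
  \<open>(a, False)\<close> its inverse.\<close>

type_synonym 'a gword = "('a \<times> bool) list"

definition letter :: "'a \<Rightarrow> 'a gword"
  where "letter a = [(a, True)]"

definition word_pow :: "'a gword \<Rightarrow> nat \<Rightarrow> 'a gword"
  where "word_pow w k = concat (replicate k w)"

text \<open>The congruence on words generated by free cancellation and by the relations \<open>u = v\<close> for
  \<open>(u, v) \<in> S\<close>; a relator \<open>w = 1\<close> is the pair \<open>(w, [])\<close>.\<close>

inductive pres_eq :: "('a gword \<times> 'a gword) set \<Rightarrow> 'a gword \<Rightarrow> 'a gword \<Rightarrow> bool"
  for S :: "('a gword \<times> 'a gword) set" where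
  pres_refl: "pres_eq S u u"
| pres_sym: "pres_eq S u v \<Longrightarrow> pres_eq S v u"
| pres_trans: "pres_eq S u v \<Longrightarrow> pres_eq S v w \<Longrightarrow> pres_eq S u w"
| pres_context: "pres_eq S u v \<Longrightarrow> pres_eq S (p @ u @ q) (p @ v @ q)"
| pres_cancel: "pres_eq S [(a, s), (a, \<not> s)] []"
| pres_relation: "(u, v) \<in> S \<Longrightarrow> pres_eq S u v"

definition pres_rel :: "('a gword \<times> 'a gword) set \<Rightarrow> ('a gword \<times> 'a gword) set"
  where "pres_rel S = {(u, v). pres_eq S u v}"

text \<open>The generators are all elements of the type \<open>'a\<close>.\<close>

definition presented_group :: "('a gword \<times> 'a gword) set \<Rightarrow> 'a gword set monoid"
  where "presented_group S =
    \<lparr>carrier = UNIV // pres_rel S,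
     mult = \<lambda>A B. \<Union>u\<in>A. \<Union>v\<in>B. pres_rel S `` {u @ v},
     one = pres_rel S `` {[]}\<rparr>"

lemma equiv_pres_rel: "equiv UNIV (pres_rel S)"
  by (rule equivI)
    (auto simp: pres_rel_def refl_on_def sym_def trans_def intro: pres_eq.intros)

lemma pres_eq_append: "pres_eq S u u' \<Longrightarrow> pres_eq S v v' \<Longrightarrow> pres_eq S (u @ v) (u' @ v')"
  using pres_context[of S u u' "[]" v] pres_context[of S v v' u' "[]"]
  by (auto intro: pres_trans)

lemma mult_presented_group:
  "pres_rel S `` {u} \<otimes>\<^bsub>presented_group S\<^esub> pres_rel S `` {v} = pres_rel S `` {u @ v}"
proof -
  have "congruent2 (pres_rel S) (pres_rel S) (\<lambda>u v. pres_rel S `` {u @ v})"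
    by (auto simp: congruent2_def pres_rel_def intro: pres_eq_append pres_trans pres_sym)
  from UN_equiv_class2[OF equiv_pres_rel equiv_pres_rel this] show ?thesis
    by (simp add: presented_group_def)
qed

lemma pres_eq_inverse: "pres_eq S (map (\<lambda>(a, s). (a, \<not> s)) (rev w) @ w) []"
proof (induction w)
  case Nil
  show ?case by (simp add: pres_refl)
next
  case (Cons l w)
  obtain a s where l: "l = (a, s)" by force
  let ?w' = "map (\<lambda>(a, s). (a, \<not> s)) (rev w)"
  have "pres_eq S (?w' @ [(a, \<not> s), (a, \<not> \<not> s)] @ w) (?w' @ [] @ w)"
    by (intro pres_context pres_cancel)
  with Cons.IH show ?case
    by (auto simp: l intro: pres_trans)
qed

lemma group_presented_group: "group (presented_group S)"
proof (rule groupI)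
  let ?G = "presented_group S"
  have carr: "carrier ?G = range (\<lambda>u. pres_rel S `` {u})"
    by (auto simp: presented_group_def quotient_def)
  have one: "\<one>\<^bsub>?G\<^esub> = pres_rel S `` {[]}"
    by (simp add: presented_group_def)
  show "\<And>x y. x \<in> carrier ?G \<Longrightarrow> y \<in> carrier ?G \<Longrightarrow> x \<otimes>\<^bsub>?G\<^esub> y \<in> carrier ?G"
    and "\<one>\<^bsub>?G\<^esub> \<in> carrier ?G"
    and "\<And>x y z. x \<in> carrier ?G \<Longrightarrow> y \<in> carrier ?G \<Longrightarrow> z \<in> carrier ?G \<Longrightarrow>
           (x \<otimes>\<^bsub>?G\<^esub> y) \<otimes>\<^bsub>?G\<^esub> z = x \<otimes>\<^bsub>?G\<^esub> (y \<otimes>\<^bsub>?G\<^esub> z)"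
    and "\<And>x. x \<in> carrier ?G \<Longrightarrow> \<one>\<^bsub>?G\<^esub> \<otimes>\<^bsub>?G\<^esub> x = x"
    by (auto simp: carr one mult_presented_group)
  fix x assume "x \<in> carrier ?G"
  then obtain w where w: "x = pres_rel S `` {w}" by (auto simp: carr)
  let ?w' = "map (\<lambda>(a, s). (a, \<not> s)) (rev w)"
  have "pres_rel S `` {?w'} \<otimes>\<^bsub>?G\<^esub> x = \<one>\<^bsub>?G\<^esub>"
    unfolding w one mult_presented_group
    by (rule equiv_class_eq[OF equiv_pres_rel]) (simp add: pres_rel_def pres_eq_inverse)
  then show "\<exists>y\<in>carrier ?G. y \<otimes>\<^bsub>?G\<^esub> x = \<one>\<^bsub>?G\<^esub>"
    by (auto simp: carr)
qed

section \<open>Coxeter groups\<close>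

definition coxeter_matrix :: "nat^'n^'n \<Rightarrow> bool"
  where "coxeter_matrix M \<longleftrightarrow>
    (\<forall>i. M $ i $ i = 1) \<and> (\<forall>i j. i \<noteq> j \<longrightarrow> M $ i $ j = M $ j $ i \<and> M $ i $ j > 1)"

definition coxeter_group :: "nat^'n^'n \<Rightarrow> 'n gword set monoid"
  where "coxeter_group M =
    presented_group {(word_pow (letter i @ letter j) (M $ i $ j), []) | i j. True}"

end

theory Submission
  imports Defs
begin

text \<open>The operations \<open>-\<close>, \<open>r\<^sub>1\<close>, \<open>*\<close> generate the group, since \<open>r\<^sub>2 = - r\<^sub>1 -\<close> and
  \<open>R = (- r\<^sub>1)\<^sup>2\<close>, and they satisfy the relations of \<open>x\<close>, \<open>y\<close>, \<open>z\<close>. These relations reduce every word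
  to one of sixteen normal forms, an alternating word in \<open>x\<close> and \<open>y\<close> of length at most four,
  possibly preceded by \<open>z\<close>; the normal forms act differently on a single matrix class, so no
  further relations hold.\<close>

section \<open>Words in the generators acting on matrix classes\<close>

definition gen :: "3 \<Rightarrow> pm_mat \<Rightarrow> pm_mat"
  where "gen i = (if i = 1 then op_minus else if i = 2 then op_r1 else op_star)"

lemma gen_simps [simp]: "gen 1 = op_minus" "gen 2 = op_r1" "gen 3 = op_star"
  by (simp_all add: gen_def)

lemma gen_gen [simp]: "gen i (gen i P) = P"
  by (simp add: gen_def elementary_ops_involutive)

text \<open>Formal inverses act as the generators themselves, because the generators are involutions.\<close>

definition word_map :: "3 gword \<Rightarrow> pm_mat \<Rightarrow> pm_mat"
  where "word_map = fold (\<lambda>(i, s). gen i)"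

lemma word_map_Nil [simp]: "word_map [] = id"
  by (simp add: word_map_def)

lemma word_map_Cons [simp]: "word_map ((i, s) # w) = word_map w \<circ> gen i"
  by (simp add: word_map_def)

lemma word_map_append [simp]: "word_map (u @ v) = word_map v \<circ> word_map u"
  by (simp add: word_map_def fold_append)

text \<open>All three generators are involutions, so normal forms and relations can be kept as plain
  index lists, without signs.\<close>

definition pos :: "'a list \<Rightarrow> 'a gword"
  where "pos = map (\<lambda>i. (i, True))"

lemma pos_simps [simp]: "pos [] = []" "pos (i # u) = (i, True) # pos u" "pos (u @ v) = pos u @ pos v"
  by (simp_all add: pos_def)

subsection \<open>The group of elementary operations\<close>

lemma op_braid: "op_r1 (op_minus (op_r1 (op_minus P))) = op_minus (op_r1 (op_minus (op_r1 P)))"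
  and op_minus_star: "op_star (op_minus P) = op_minus (op_star P)"
  and op_r1_star: "op_star (op_r1 P) = op_r1 (op_star P)"
  and op_r2_eq: "op_r2 P = op_minus (op_r1 (op_minus P))"
  and op_R_eq: "op_R P = op_r1 (op_minus (op_r1 (op_minus P)))"
  by (transfer; simp add: vec_eq_iff forall_2)+

text \<open>Reading a word backwards undoes it, since each letter acts as an involution. This makes
  the word maps closed under inverses in \<open>carrier_G_F\<close>.\<close>

lemma word_map_inverse: "\<exists>v. word_map v \<circ> word_map u = id"
proof (induction u)
  case Nil
  show ?case by (rule exI[of _ "[]"]) simp
next
  case (Cons l u)
  obtain i s where l: "l = (i, s)" by force
  from Cons.IH obtain v where v: "word_map v \<circ> word_map u = id" ..
  have "word_map v (word_map u P) = P" for P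
    using fun_cong[OF v, of P] by simp
  then have "word_map (v @ [(i, s)]) \<circ> word_map (l # u) = id"
    by (simp add: l fun_eq_iff)
  then show ?case ..
qed

text \<open>Each word map is a product of generators; conversely, the word maps form a subgroup that
  contains all five operations.\<close>

lemma carrier_G_F: "carrier G_F = range word_map"
proof -
  let ?O = "opposite_group (BijGroup UNIV) :: (pm_mat \<Rightarrow> pm_mat) monoid"
  interpret O: group ?O
    by (intro group_opposite_group group_BijGroup)
  have mult: "f \<otimes>\<^bsub>?O\<^esub> g = g \<circ> f" if "f \<in> carrier ?O" "g \<in> carrier ?O" for f g
    using that by (auto simp: opposite_group_def BijGroup_def compose_def fun_eq_iff)
  have one: "\<one>\<^bsub>?O\<^esub> = id"
    by (auto simp: opposite_group_def BijGroup_def)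
  have carr: "carrier G_F = generate ?O elementary_ops"
    using elementary_ops_in_carrier
    by (simp add: G_F_def carrier_subgroup_generated Int_absorb1)
  have gen_carr: "gen i \<in> elementary_ops" for i
    by (simp add: gen_def elementary_ops_def)
  have word_carr: "word_map u \<in> carrier ?O" for u
  proof (induction u)
    case Nil
    show ?case by (metis O.one_closed one word_map_Nil)
  next
    case (Cons l u)
    obtain i s where l: "l = (i, s)" by force
    have "gen i \<in> carrier ?O" using gen_carr elementary_ops_in_carrier by blast
    with Cons.IH show ?case by (metis O.m_closed l mult word_map_Cons)
  qed
  have "word_map u \<in> generate ?O elementary_ops" for u
  proof (induction u)
    case Nil
    show ?case by (metis generate.one one word_map_Nil)
  next
    case (Cons l u)
    obtain i s where l: "l = (i, s)" by force
    have "gen i \<otimes>\<^bsub>?O\<^esub> word_map u \<in> generate ?O elementary_ops"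
      by (intro generate.eng Cons.IH generate.incl gen_carr)
    moreover have "gen i \<in> carrier ?O" using gen_carr elementary_ops_in_carrier by blast
    ultimately show ?case by (metis l mult word_carr word_map_Cons)
  qed
  moreover have "subgroup (range word_map) ?O"
  proof (rule O.subgroupI)
    show "range word_map \<subseteq> carrier ?O" using word_carr by auto
    show "range word_map \<noteq> {}" by simp
  next
    fix f assume "f \<in> range word_map"
    then obtain u where u: "f = word_map u" by auto
    \<comment> \<open>In the opposite group, \<open>v\<close> inverting \<open>u\<close> from the
      left means \<open>word_map u \<circ> word_map v = id\<close>, the reverse of what
      \<open>word_map_inverse\<close> gives. A left inverse \<open>w\<close> of \<open>v\<close> has
      to act as \<open>u\<close>, which supplies it.\<close>
    obtain v where v: "word_map v \<circ> word_map u = id" using word_map_inverse by blast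
    obtain w where w: "word_map w \<circ> word_map v = id" using word_map_inverse by blast
    have "word_map w = word_map w \<circ> (word_map v \<circ> word_map u)" by (simp add: v)
    also have "\<dots> = word_map u" by (simp add: o_assoc w)
    finally have "inv\<^bsub>?O\<^esub> f = word_map v"
      using w by (intro O.inv_equality) (auto simp: u mult one word_carr)
    then show "inv\<^bsub>?O\<^esub> f \<in> range word_map" by simp
  next
    fix f g assume "f \<in> range word_map" "g \<in> range word_map"
    then obtain u v where "f = word_map u" "g = word_map v" by auto
    then show "f \<otimes>\<^bsub>?O\<^esub> g \<in> range word_map"
      by (metis mult rangeI word_carr word_map_append)
  qed
  moreover have "elementary_ops \<subseteq> range word_map"
  proof -
    have "op_minus = word_map (pos [1])" "op_r1 = word_map (pos [2])"
      "op_star = word_map (pos [3])" "op_r2 = word_map (pos [1, 2, 1])"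
      "op_R = word_map (pos [1, 2, 1, 2])"
      by (simp_all add: fun_eq_iff op_r2_eq op_R_eq)
    then show ?thesis unfolding elementary_ops_def by (metis empty_subsetI insert_subset rangeI)
  qed
  ultimately show ?thesis
    unfolding carr using O.generate_subgroup_incl by blast
qed

subsection \<open>Normal forms\<close>

text \<open>Reduced words for the dihedral group of order 8. The longest element has two reduced
  words, and only \<open>[1,2,1,2]\<close> is listed.\<close>

definition dihedral_forms :: "3 list list"
  where "dihedral_forms = [[], [1], [2], [1,2], [2,1], [1,2,1], [2,1,2], [1,2,1,2]]"

definition normal_forms :: "3 list list"
  where "normal_forms = dihedral_forms @ map ((#) 3) dihedral_forms"

lemma inj_on_normal_forms: "inj_on (\<lambda>n. word_map (pos n)) (set normal_forms)"
proof -
  let ?P = "pm_class (mat22 1 2 3 4)" \<comment> \<open>a class with trivial stabiliser\<close>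
  have class_eq: "pm_class A = pm_class B \<longleftrightarrow> A = B \<or> A = - B" for A B
    by (rule pm_mat.abs_eq_iff)
  have "distinct (map (\<lambda>n. word_map (pos n) ?P) normal_forms)"
    \<comment> \<open>The sixteen images are computed first; only then is distinctness unfolded into
      comparisons of entries up to sign.\<close>
    by (simp add: normal_forms_def dihedral_forms_def elementary_ops_class del: distinct.simps)
      (simp only: distinct.simps list.set insert_iff empty_iff class_eq uminus_mat22 mat22_eq_iff, simp)
  then have "inj_on (\<lambda>n. word_map (pos n) ?P) (set normal_forms)"
    by (simp add: distinct_map)
  then show ?thesis
    by (auto simp: inj_on_def)
qed

text \<open>Captures what the three presentations share: the derived relations leave at most sixteen
  classes of words, and \<open>sound_relation\<close> lets the classes act on matrices, which keeps
  normal forms apart.\<close>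

locale dihedral_times_two =
  fixes S :: "(3 gword \<times> 3 gword) set"
  assumes square: "pres_eq S (pos [i, i]) []"
    and braid: "pres_eq S (pos [1,2,1,2]) (pos [2,1,2,1])"
    and comm_1_3: "pres_eq S (pos [1,3]) (pos [3,1])"
    and comm_2_3: "pres_eq S (pos [2,3]) (pos [3,2])"
    and sound_relation: "(u, v) \<in> S \<Longrightarrow> word_map u = word_map v"
begin

abbreviation eqv (infix "\<sim>" 50)
  where "u \<sim> v \<equiv> pres_eq S (pos u) (pos v)"

lemma eqv_Cons: "u \<sim> v \<Longrightarrow> i # u \<sim> i # v"
  using pres_context[of S "pos u" "pos v" "[(i, True)]" "[]"] by simp

lemma eqv_append: "u \<sim> v \<Longrightarrow> u @ w \<sim> v @ w"
  using pres_context[of S "pos u" "pos v" "[]" "pos w"] by simp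

lemma cancel: "i # i # u \<sim> u"
  using pres_context[OF square, of "[]" i "pos u"] by simp

text \<open>A new first letter either cancels or prolongs the alternation. The braid relation enters
  only when 2 is put before \<open>[1,2,1]\<close> or \<open>[1,2,1,2]\<close>, which are the facts
  \<open>1\<close> and \<open>2\<close> below.\<close>

lemma dihedral_step:
  assumes "n \<in> set dihedral_forms" "i = 1 \<or> i = 2"
  shows "\<exists>n'\<in>set dihedral_forms. i # n \<sim> n'"
proof -
  have 1: "[2,1,2,1] \<sim> [1,2,1,2]" using braid by (rule pres_sym)
  have "[2,1,2,1] @ [2] \<sim> [1,2,1,2] @ [2]" by (rule eqv_append[OF 1])
  moreover have "[1,2,1,2,2] \<sim> [1,2,1]" by (intro eqv_Cons cancel)
  ultimately have 2: "[2,1,2,1,2] \<sim> [1,2,1]" by (auto intro: pres_trans)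
  have refl: "u \<sim> u" for u by (rule pres_refl)
  show ?thesis
    using assms unfolding dihedral_forms_def
    by (auto simp del: pos_simps intro: cancel refl 1 2)
qed

lemma normal_step:
  assumes "n \<in> set normal_forms"
  shows "\<exists>n'\<in>set normal_forms. i # n \<sim> n'"
proof -
  consider (d) "n \<in> set dihedral_forms" | (z) d where "d \<in> set dihedral_forms" "n = 3 # d"
    using assms by (auto simp: normal_forms_def)
  then show ?thesis
  proof cases
    case d
    show ?thesis
    proof (cases "i = 3")
      case True
      with d show ?thesis
        by (intro bexI[of _ "3 # n"] pres_refl) (auto simp: normal_forms_def intro: pres_refl)
    next
      case False
      then have "i = 1 \<or> i = 2" using exhaust_3[of i] by auto
      with dihedral_step[OF d] show ?thesis by (auto simp: normal_forms_def)
    qed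
  next
    case z
    show ?thesis
    proof (cases "i = 3")
      case True
      with z cancel show ?thesis by (auto simp: normal_forms_def simp del: pos_simps)
    next
      case False
      then have i: "i = 1 \<or> i = 2" using exhaust_3[of i] by auto
      \<comment> \<open>The letter \<open>i\<close> commutes past the leading 3 and is then absorbed
        by the dihedral part.\<close>
      then obtain d' where d': "d' \<in> set dihedral_forms" "i # d \<sim> d'"
        using dihedral_step z by blast
      have "[i, 3] \<sim> [3, i]" using i comm_1_3 comm_2_3 by auto
      from eqv_append[OF this, of d] have "i # n \<sim> 3 # i # d" using z by simp
      also note eqv_Cons[OF d'(2), of 3]
      finally (pres_trans) have "i # n \<sim> 3 # d'" .
      moreover have "3 # d' \<in> set normal_forms" using d'(1) by (simp add: normal_forms_def)
      ultimately show ?thesis by blast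
    qed
  qed
qed

text \<open>The word consisting of the inverse of \<open>i\<close> followed by \<open>i\<close>
  twice reduces to \<open>i\<close> by free cancellation and to the inverse of \<open>i\<close> by
  the square relation.\<close>

lemma positive_letter: "pres_eq S [(i, s)] [(i, True)]"
proof (cases s)
  case False
  have "pres_eq S [(i, False), (i, True), (i, True)] [(i, True)]"
    using pres_context[OF pres_cancel[of S i False], of "[]" "[(i, True)]"] by simp
  moreover have "pres_eq S [(i, False), (i, True), (i, True)] [(i, False)]"
    using pres_context[OF square[of i], of "[(i, False)]" "[]"] by simp
  ultimately show ?thesis
    using False by (auto intro: pres_trans pres_sym)
qed (auto intro: pres_refl)

lemma normal_form_exists: "\<exists>n\<in>set normal_forms. pres_eq S w (pos n)"
proof (induction w)
  case Nil
  show ?case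
    by (rule bexI[of _ "[]"]) (auto simp: normal_forms_def dihedral_forms_def intro: pres_refl)
next
  case (Cons l w)
  obtain i s where l: "l = (i, s)" by force
  obtain n where n: "n \<in> set normal_forms" "pres_eq S w (pos n)" using Cons.IH by blast
  obtain n' where n': "n' \<in> set normal_forms" "i # n \<sim> n'" using normal_step n by blast
  have "pres_eq S (l # w) (pos (i # n))"
    using pres_eq_append[OF positive_letter[of i s] n(2)] by (simp add: l)
  with n' show ?case by (blast intro: pres_trans)
qed

lemma pres_eq_sound: "pres_eq S u v \<Longrightarrow> word_map u = word_map v"
  by (induction rule: pres_eq.induct) (auto simp: sound_relation fun_eq_iff)

text \<open>The action is faithful: words that act alike have normal forms that act alike, and these
  coincide by \<open>inj_on_normal_forms\<close>.\<close>

lemma pres_eq_iff: "pres_eq S u v \<longleftrightarrow> word_map u = word_map v"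
proof
  assume eq: "word_map u = word_map v"
  obtain m n where mn: "m \<in> set normal_forms" "pres_eq S u (pos m)"
      "n \<in> set normal_forms" "pres_eq S v (pos n)"
    using normal_form_exists by meson
  then have "word_map (pos m) = word_map (pos n)"
    using eq pres_eq_sound by metis
  then have "m = n"
    using inj_on_normal_forms mn by (auto dest: inj_onD)
  then show "pres_eq S u v"
    using mn by (blast intro: pres_trans pres_sym)
qed (rule pres_eq_sound)

lemma G_F_iso: "G_F \<cong> presented_group S"
proof -
  \<comment> \<open>By \<open>pres_eq_iff\<close> the fibres of \<open>word_map\<close> are exactly
    the congruence classes, so sending a map to its fibre needs no choice of representative.\<close>
  let ?f = "\<lambda>g. {w. word_map w = g}"
  have f: "?f (word_map u) = pres_rel S `` {u}" for u
    by (auto simp: pres_rel_def pres_eq_iff)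
  have carr: "carrier (presented_group S) = range (\<lambda>u. pres_rel S `` {u})"
    by (auto simp: presented_group_def quotient_def)
  have "?f \<in> hom G_F (presented_group S)"
  proof (rule homI)
    fix g h assume gh: "g \<in> carrier G_F" "h \<in> carrier G_F"
    then obtain u v where uv: "g = word_map u" "h = word_map v" by (auto simp: carrier_G_F)
    \<comment> \<open>Multiplication in \<open>G_F\<close> applies the left factor first, just as a
      word is read, so products correspond to concatenation.\<close>
    have "?f (g \<otimes>\<^bsub>G_F\<^esub> h) = ?f (word_map (u @ v))"
      using gh by (simp add: mult_G_F uv)
    also have "\<dots> = ?f g \<otimes>\<^bsub>presented_group S\<^esub> ?f h"
      unfolding uv f mult_presented_group ..
    finally show "?f (g \<otimes>\<^bsub>G_F\<^esub> h) = ?f g \<otimes>\<^bsub>presented_group S\<^esub> ?f h" .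
  qed (auto simp: carrier_G_F carr f)
  moreover have "bij_betw ?f (carrier G_F) (carrier (presented_group S))"
    unfolding bij_betw_def
  proof
    show "inj_on ?f (carrier G_F)" by (rule inj_onI) (auto simp: carrier_G_F)
    show "?f ` carrier G_F = carrier (presented_group S)"
      by (simp add: carrier_G_F carr image_image f)
  qed
  ultimately show ?thesis by (auto simp: is_iso_def iso_def)
qed

end

section \<open>From power relators to braid and commutation relations\<close>

lemma pres_eq_of_inverse:
  assumes "pres_eq S (u @ v) []" "pres_eq S (v @ w) []"
  shows "pres_eq S u w"
proof -
  have "pres_eq S (u @ v @ w) u"
    using pres_context[OF assms(2), of u "[]"] by simp
  moreover have "pres_eq S (u @ v @ w) w"
    using pres_context[OF assms(1), of "[]" w] by simp
  ultimately show ?thesis by (blast intro: pres_trans pres_sym)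
qed

lemma pres_eq_pos_rev:
  assumes "\<And>i. pres_eq S (pos [i, i]) []"
  shows "pres_eq S (pos (u @ rev u)) []"
proof (induction u)
  case (Cons i u)
  have "pres_eq S (pos (i # (u @ rev u) @ [i])) (pos [i, i])"
    using pres_context[OF Cons.IH, of "[(i, True)]" "[(i, True)]"] by simp
  with assms[of i] show ?case by (auto intro: pres_trans)
qed (simp add: pres_refl)

text \<open>With involutive generators \<open>rev u\<close> inverts \<open>u\<close>, while the
  second assumption makes \<open>u\<close> its own inverse; inverses are unique. This turns
  \<open>(xy)^4 = 1\<close> into \<open>xyxy = yxyx\<close> and \<open>(xz)^2 = 1\<close> into
  \<open>xz = zx\<close>.\<close>

lemma pres_eq_rev:
  assumes "\<And>i. pres_eq S (pos [i, i]) []" "pres_eq S (pos (u @ u)) []"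
  shows "pres_eq S (pos u) (pos (rev u))"
  using assms(2) pres_eq_pos_rev[OF assms(1), of u]
  by - (rule pres_eq_of_inverse[where v = "pos u"]; simp)

lemma dihedral_times_twoI:
  assumes square: "\<And>i. pres_eq S (pos [i, i]) []"
    and "pres_eq S (pos [1,2,1,2,1,2,1,2]) []" "pres_eq S (pos [1,3,1,3]) []"
      "pres_eq S (pos [2,3,2,3]) []"
    and "\<And>u v. (u, v) \<in> S \<Longrightarrow> word_map u = word_map v"
  shows "dihedral_times_two S"
proof
  show "pres_eq S (pos [1,2,1,2]) (pos [2,1,2,1])"
    using pres_eq_rev[of S "[1,2,1,2]", OF square] assms(2) by simp
  show "pres_eq S (pos [1,3]) (pos [3,1])"
    using pres_eq_rev[of S "[1,3]", OF square] assms(3) by simp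
  show "pres_eq S (pos [2,3]) (pos [3,2])"
    using pres_eq_rev[of S "[2,3]", OF square] assms(4) by simp
qed (fact assms)+

section \<open>Verification of the three presentations\<close>

lemmas word_defs = letter_def word_pow_def eval_nat_numeral
text \<open>Oriented left to right, these rules cancel squares, move \<open>op_star\<close> inward
  and replace one alternating product of length four by the other, which suffices to check every
  relator.\<close>

lemmas op_relations = elementary_ops_involutive op_braid op_minus_star op_r1_star

theorem theorem4p25:
  fixes x y z :: "3 gword" and M :: "nat^3^3"
  defines "x \<equiv> letter 1" and "y \<equiv> letter 2" and "z \<equiv> letter 3"
    and "M \<equiv> vector [vector [1, 4, 2], vector [4, 1, 2], vector [2, 2, 1]]"
  shows "G_F \<cong> presented_group
           {(word_pow x 2, []), (word_pow y 2, []), (word_pow z 2, []),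
            (x @ y @ x @ y, y @ x @ y @ x), (x @ z, z @ x), (y @ z, z @ y)}
       \<and> coxeter_matrix M
       \<and> G_F \<cong> coxeter_group M
       \<and> G_F \<cong> presented_group
           {(word_pow x 2, []), (word_pow y 2, []), (word_pow z 2, []),
            (word_pow (x @ y) 4, []), (word_pow (y @ x) 4, []),
            (word_pow (x @ z) 2, []), (word_pow (z @ x) 2, []),
            (word_pow (y @ z) 2, []), (word_pow (z @ y) 2, [])}"
    (is "G_F \<cong> presented_group ?S1 \<and> _ \<and> _ \<and> G_F \<cong> presented_group ?S2")
proof (intro conjI)
  have square: "pres_eq S (pos [i, i]) []"
    if "(word_pow x 2, []) \<in> S" "(word_pow y 2, []) \<in> S" "(word_pow z 2, []) \<in> S" for S i
    using exhaust_3[of i] that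
    by (auto simp: x_def y_def z_def word_defs intro: pres_relation)
  have "dihedral_times_two ?S1"
  proof
    show "pres_eq ?S1 (pos [i, i]) []" for i
      by (rule square) simp_all
    show "word_map u = word_map v" if "(u, v) \<in> ?S1" for u v
      using that
      by (elim insertE emptyE)
        (simp_all add: x_def y_def z_def word_defs fun_eq_iff op_relations)
  qed (rule pres_relation; simp add: x_def y_def z_def word_defs)+
  then show "G_F \<cong> presented_group ?S1"
    by (rule dihedral_times_two.G_F_iso)
  have "dihedral_times_two ?S2"
  proof (rule dihedral_times_twoI)
    show "pres_eq ?S2 (pos [i, i]) []" for i
      by (rule square) simp_all
    show "word_map u = word_map v" if "(u, v) \<in> ?S2" for u v
      using that
      by (elim insertE emptyE)
        (simp_all add: x_def y_def z_def word_defs fun_eq_iff op_relations)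
  qed (rule pres_relation; simp add: x_def y_def z_def word_defs)+
  then show "G_F \<cong> presented_group ?S2"
    by (rule dihedral_times_two.G_F_iso)
  have M: "M $ 1 $ 1 = 1" "M $ 1 $ 2 = 4" "M $ 1 $ 3 = 2" "M $ 2 $ 1 = 4" "M $ 2 $ 2 = 1"
    "M $ 2 $ 3 = 2" "M $ 3 $ 1 = 2" "M $ 3 $ 2 = 2" "M $ 3 $ 3 = 1"
    by (simp_all add: M_def)
  then show "coxeter_matrix M"
    by (simp add: coxeter_matrix_def forall_3)
  let ?C = "{(word_pow (letter i @ letter j) (M $ i $ j), []) | i j. True}"
  have relator: "pres_eq ?C (word_pow (letter i @ letter j) (M $ i $ j)) []" for i j
    by (rule pres_relation) blast
  have "dihedral_times_two ?C"
  proof (rule dihedral_times_twoI)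
    \<comment> \<open>Diagonal entries of \<open>M\<close> are 1, so the relator of the pair
      \<open>(i, i)\<close> is the square of the generator \<open>i\<close>.\<close>
    show "pres_eq ?C (pos [i, i]) []" for i
      using exhaust_3[of i] relator[of i i] M by (auto simp: word_defs)
    show "pres_eq ?C (pos [1,2,1,2,1,2,1,2]) []"
      using relator[of 1 2] M by (simp add: word_defs)
    show "pres_eq ?C (pos [1,3,1,3]) []"
      using relator[of 1 3] M by (simp add: word_defs)
    show "pres_eq ?C (pos [2,3,2,3]) []"
      using relator[of 2 3] M by (simp add: word_defs)
    have "word_map (word_pow (letter i @ letter j) (M $ i $ j)) = word_map []" for i j
      using exhaust_3[of i] exhaust_3[of j] M
      by (elim disjE) (simp_all add: word_defs fun_eq_iff op_relations)
    then show "word_map u = word_map v" if "(u, v) \<in> ?C" for u v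
      using that by blast
  qed
  then show "G_F \<cong> coxeter_group M"
    unfolding coxeter_group_def by (rule dihedral_times_two.G_F_iso)
qed

end
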